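(* Let $k\ge 2$ and let $\tau_k$ be a task with $k-1$ higher-priority tasks $\tau_1,\dots,\tau_{k-1}$. Suppose a $k$-point effective schedulability test for $\tau_k$ under a given fixed-priority scheduling algorithm is given, with points $0<t_1\le t_2\le\cdots\le t_k$ and parameters $C_k>0$, $0<U_i\le 1$, $\alpha_i$, $\beta_i$ ($1\le i\le k-1$), and suppose that $\alpha,\beta$ are real numbers with $0<\alpha_i\le\alpha$ and $0<\beta_i\le\beta$ for all $i=1,\dots,k-1$. Then $\tau_k$ is schedulable by the scheduling algorithm if $$\frac{C_k}{t_k}\le \frac{\frac{\alpha}{\beta}+1}{\prod_{j=1}^{k-1}(\beta U_j+1)}-\frac{\alpha}{\beta}.$$
   Context: A $k$-point effective schedulability test is a sufficient schedulability test for $\tau_k$ under a fixed-priority scheduling policy that, for given $0<t_1\le t_2\le\cdots\le t_k$, verifies the existence of an index $j\in\{1,\dots,k\}$ such that $$C_k+\sum_{i=1}^{k-1}\alpha_i t_iU_i+\sum_{i=1}^{j-1}\beta_i t_iU_i\le t_j,$$ where $C_k>0$, $\alpha_i>0$, $U_i>0$, $\beta_i>0$ are constants depending on the task model and on task $\tau_i$. "Sufficient" means: if such an index $j$ exists, then $\tau_k$ is schedulable (all its jobs meet their deadlines) under the policy. It is assumed throughout that $0<U_i\le 1$. *)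

theory Defs
  imports "HOL-Analysis.Analysis"
begin

text \<open>
  A run records the jobs that a task system releases together with the schedule produced for them.
  Which processors a job may be dispatched to at a given time is data of the run, so the same notion
  covers self-suspension (not eligible while suspended), non-preemptive execution (no other job is
  eligible on the processor meanwhile), and uniprocessor, partitioned and global multiprocessor
  scheduling.
\<close>

record ('task, 'job, 'proc) run =
  jobs :: "'job set"
  task_of :: "'job \<Rightarrow> 'task"
  release :: "'job \<Rightarrow> real"
  deadline :: "'job \<Rightarrow> real"  \<comment> \<open>absolute, not relative to the release\<close>
  demand :: "'job \<Rightarrow> real"  \<comment> \<open>the execution time the job actually requires\<close>
  eligible :: "'job \<Rightarrow> 'proc \<Rightarrow> real \<Rightarrow> bool"
  exec :: "'proc \<Rightarrow> real \<Rightarrow> 'job option"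

definition service :: "'proc set \<Rightarrow> ('task, 'job, 'proc) run \<Rightarrow> 'job \<Rightarrow> real \<Rightarrow> real" where
  "service P \<sigma> J x =
     (\<Sum>p\<in>P. measure lborel {y. release \<sigma> J \<le> y \<and> y \<le> x \<and> exec \<sigma> p y = Some J})"

definition meets_deadline :: "'proc set \<Rightarrow> ('task, 'job, 'proc) run \<Rightarrow> 'job \<Rightarrow> bool" where
  "meets_deadline P \<sigma> J \<longleftrightarrow> demand \<sigma> J \<le> service P \<sigma> J (deadline \<sigma> J)"

text \<open>
  Priorities belong to tasks and do not change over time; a smaller value of \<open>prio\<close> means a higher
  priority. The last conjunct says that an eligible job waits for a processor only while that
  processor executes a job of no lower priority.
\<close>

definition fixed_priority_run ::
    "'task set \<Rightarrow> 'proc set \<Rightarrow> ('task \<Rightarrow> nat) \<Rightarrow> ('task, 'job, 'proc) run \<Rightarrow> bool" where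
  "fixed_priority_run T P prio \<sigma> \<longleftrightarrow>
     (\<forall>J\<in>jobs \<sigma>. task_of \<sigma> J \<in> T \<and> release \<sigma> J \<le> deadline \<sigma> J \<and> 0 \<le> demand \<sigma> J) \<and>
     (\<forall>p\<in>P. \<forall>J\<in>jobs \<sigma>. {y. exec \<sigma> p y = Some J} \<in> sets lborel) \<and>
     (\<forall>J p y. eligible \<sigma> J p y \<longrightarrow>
        J \<in> jobs \<sigma> \<and> p \<in> P \<and> release \<sigma> J \<le> y \<and> service P \<sigma> J y < demand \<sigma> J) \<and>
     (\<forall>J p y. exec \<sigma> p y = Some J \<longrightarrow> eligible \<sigma> J p y) \<and>
     (\<forall>J p y. eligible \<sigma> J p y \<and> (\<forall>q. exec \<sigma> q y \<noteq> Some J) \<longrightarrow>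
        (\<exists>J'. exec \<sigma> p y = Some J' \<and> prio (task_of \<sigma> J') \<le> prio (task_of \<sigma> J)))"

text \<open>
  A scheduling algorithm, applied to a task system, is represented by the set of all runs it can
  produce over the job releases that the task model permits.
\<close>

definition fixed_priority_algorithm ::
    "'task set \<Rightarrow> 'proc set \<Rightarrow> ('task \<Rightarrow> nat) \<Rightarrow> ('task, 'job, 'proc) run set \<Rightarrow> bool" where
  "fixed_priority_algorithm T P prio A \<longleftrightarrow>
     finite T \<and> finite P \<and> inj_on prio T \<and> (\<forall>\<sigma>\<in>A. fixed_priority_run T P prio \<sigma>)"

definition schedulable :: "'proc set \<Rightarrow> ('task, 'job, 'proc) run set \<Rightarrow> 'task \<Rightarrow> bool" where
  "schedulable P A a \<longleftrightarrow>
     (\<forall>\<sigma>\<in>A. \<forall>J\<in>jobs \<sigma>. task_of \<sigma> J = a \<longrightarrow> meets_deadline P \<sigma> J)"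

text \<open>
  The argument \<open>a\<close> is the task under analysis (\<open>\<tau>\<^sub>k\<close>) and \<open>C\<close> is its constant \<open>C\<^sub>k\<close>.
\<close>

definition k_point_effective_test ::
    "'proc set \<Rightarrow> ('task, 'job, 'proc) run set \<Rightarrow> 'task \<Rightarrow> nat \<Rightarrow> (nat \<Rightarrow> real) \<Rightarrow> real \<Rightarrow>
     (nat \<Rightarrow> real) \<Rightarrow> (nat \<Rightarrow> real) \<Rightarrow> (nat \<Rightarrow> real) \<Rightarrow> bool" where
  "k_point_effective_test P A a k t C U \<alpha> \<beta> \<longleftrightarrow>
     (\<forall>i\<in>{1..k}. 0 < t i) \<and> mono_on {1..k} t \<and> 0 < C \<and>
     (\<forall>i\<in>{1..k-1}. 0 < \<alpha> i \<and> 0 < U i \<and> 0 < \<beta> i) \<and>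
     ((\<exists>j\<in>{1..k}. C + (\<Sum>i=1..k-1. \<alpha> i * t i * U i) + (\<Sum>i=1..j-1. \<beta> i * t i * U i) \<le> t j)
        \<longrightarrow> schedulable P A a)"

end

(* If every point of the test fails, the left-hand sides
     S j = C + a * W + b * (sum of t i * U i over i < j),   W = sum of t i * U i over all i,
   for the uniform parameters a, b satisfy t j < S j, so S (j + 1) <= S j * (1 + b * U j).
   Multiplying up gives S k <= (C + a * W) * (product of the 1 + b * U i).  Since W is determined
   by S k = C + (a + b) * W, and t k < S k, this forces C / t k above the hyperbolic bound. *)

theory Submission
  imports Defs
begin

text \<open>A discrete Gronwall inequality: since \<open>t j\<close> is at most the left-hand side
  up to \<open>j-1\<close>, adding the next term multiplies that side by at most
  \<open>b * U j + 1\<close>. \<open>D\<close> is arbitrary, so it can absorb a sum over all the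
  points.\<close>

lemma additive_recursion_le_prod:
  fixes U t :: "nat \<Rightarrow> real"
  assumes "0 \<le> b" "\<And>i. i \<in> {1..n} \<Longrightarrow> 0 \<le> U i"
    and "\<And>j. j \<in> {1..n} \<Longrightarrow> t j \<le> D + b * (\<Sum>i=1..j-1. t i * U i)"
  shows "D + b * (\<Sum>i=1..n. t i * U i) \<le> D * (\<Prod>j=1..n. (b * U j + 1))"
  using assms
proof (induction n)
  case 0
  then show ?case by simp
next
  case (Suc n)
  let ?S = "D + b * (\<Sum>i=1..n. t i * U i)"
  have U: "0 \<le> b * U (Suc n)" using Suc.prems(1,2) by simp
  have "t (Suc n) \<le> ?S" using Suc.prems(3)[of "Suc n"] by simp
  then have "b * U (Suc n) * t (Suc n) \<le> b * U (Suc n) * ?S"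
    using U by (rule mult_left_mono)
  then have "D + b * (\<Sum>i=1..Suc n. t i * U i) \<le> ?S * (b * U (Suc n) + 1)"
    by (simp add: algebra_simps)
  also have "\<dots> \<le> D * (\<Prod>j=1..n. (b * U j + 1)) * (b * U (Suc n) + 1)"
    using U Suc.prems by (intro mult_right_mono Suc.IH) auto
  finally show ?case by (simp add: mult.assoc)
qed

text \<open>In use, \<open>s\<close> is the last point and \<open>Q\<close> the product. Eliminating
  \<open>W\<close> between \<open>less\<close> and \<open>le\<close> leaves a bound on
  \<open>c / s\<close> alone.\<close>

lemma hyperbolic_bound_less:
  fixes a b c s W Q :: real
  assumes "0 < a" "0 < b" "0 < c" "0 < s" "0 < Q"
    and less: "s < c + (a + b) * W"
    and le: "c + (a + b) * W \<le> (c + a * W) * Q"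
  shows "(a / b + 1) / Q - a / b < c / s"
\<comment> \<open>This quantity is \<open>b\<close> times the claimed bound. If it is not positive,
  positivity of \<open>c / s\<close> suffices; otherwise \<open>less\<close> may be multiplied by
  it.\<close>
proof (cases "(a + b) / Q - a \<le> 0")
  case True
  have "(a / b + 1) / Q - a / b = ((a + b) / Q - a) / b"
    using assms(2,5) by (simp add: field_simps)
  also have "\<dots> \<le> 0" using True assms(2) by (simp add: divide_le_0_iff)
  also have "\<dots> < c / s" using assms(3,4) by simp
  finally show ?thesis .
next
  case False
  let ?X = "c + (a + b) * W"
  have "?X / Q \<le> c + a * W" using le \<open>0 < Q\<close> by (simp add: pos_divide_le_eq)
  \<comment> \<open>The factor \<open>a + b\<close> makes the right-hand side depend on
    \<open>W\<close> only through \<open>?X\<close>.\<close>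
  then have "(a + b) * (?X / Q) \<le> (a + b) * (c + a * W)"
    using assms(1,2) by (intro mult_left_mono) auto
  moreover have "(a + b) * (c + a * W) = b * c + a * ?X"
    by (simp add: algebra_simps)
  ultimately have "?X * ((a + b) / Q - a) \<le> b * c"
    by (simp add: right_diff_distrib mult.commute[of ?X])
  moreover have "s * ((a + b) / Q - a) < ?X * ((a + b) / Q - a)"
    using less False by (intro mult_strict_right_mono) auto
  ultimately have "((a + b) / Q - a) * s < c * b"
    by (simp add: mult.commute)
  then have "((a + b) / Q - a) / b < c / s"
    using assms(2,4) by (simp add: divide_less_eq less_divide_eq mult.commute)
  moreover have "(a / b + 1) / Q - a / b = ((a + b) / Q - a) / b"
    using assms(2,5) by (simp add: field_simps)
  ultimately show ?thesis by simp
qed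

theorem lemma1:
  fixes T :: "'task set" and P :: "'proc set" and prio :: "'task \<Rightarrow> nat"
    and A :: "('task, 'job, 'proc) run set"
    and \<tau> :: "nat \<Rightarrow> 'task" and k :: nat
    and t U \<alpha> \<beta> :: "nat \<Rightarrow> real" and C \<alpha>max \<beta>max :: real
  assumes "2 \<le> k"
    and "fixed_priority_algorithm T P prio A"
    and "\<tau> k \<in> T"
    and "bij_betw \<tau> {1..k-1} {a \<in> T. prio a < prio (\<tau> k)}"
    and "k_point_effective_test P A (\<tau> k) k t C U \<alpha> \<beta>"
    and "\<And>i. i \<in> {1..k-1} \<Longrightarrow> U i \<le> 1"
    and "\<And>i. i \<in> {1..k-1} \<Longrightarrow> 0 < \<alpha> i \<and> \<alpha> i \<le> \<alpha>max"
    and "\<And>i. i \<in> {1..k-1} \<Longrightarrow> 0 < \<beta> i \<and> \<beta> i \<le> \<beta>max"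
    and "C / t k \<le> (\<alpha>max / \<beta>max + 1) / (\<Prod>j=1..k-1. (\<beta>max * U j + 1)) - \<alpha>max / \<beta>max"
  shows "schedulable P A (\<tau> k)"
proof (rule ccontr)
  assume not_sched: "\<not> schedulable P A (\<tau> k)"
  let ?w = "\<lambda>i. t i * U i"
  let ?W = "\<Sum>i=1..k-1. ?w i"
  have test: "\<forall>i\<in>{1..k}. 0 < t i" "0 < C" "\<forall>i\<in>{1..k-1}. 0 < U i"
    and fails: "\<And>j. j \<in> {1..k} \<Longrightarrow>
      t j < C + (\<Sum>i=1..k-1. \<alpha> i * t i * U i) + (\<Sum>i=1..j-1. \<beta> i * t i * U i)"
    using assms(5) not_sched unfolding k_point_effective_test_def by (auto simp: not_le)
  \<comment> \<open>\<open>2 \<le> k\<close> supplies an index whose parameters force both upper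
    bounds to be positive.\<close>
  have "1 \<in> {1..k-1}" using assms(1) by auto
  then have pos: "0 < \<alpha>max" "0 < \<beta>max"
    using assms(7)[of 1] assms(8)[of 1] by linarith+
  have w: "0 \<le> ?w i" if "i \<in> {1..k-1}" for i
    using test that by (auto intro!: mult_nonneg_nonneg less_imp_le)
  have less: "t j < (C + \<alpha>max * ?W) + \<beta>max * (\<Sum>i=1..j-1. ?w i)" if "j \<in> {1..k}" for j
  proof -
    \<comment> \<open>Every point still fails with the larger uniform parameters, as each
      \<open>?w i\<close> is nonnegative.\<close>
    have "(\<Sum>i=1..k-1. \<alpha> i * t i * U i) \<le> \<alpha>max * ?W"
      unfolding sum_distrib_left mult.assoc
      using w assms(7) by (intro sum_mono mult_right_mono) auto
    moreover have "(\<Sum>i=1..j-1. \<beta> i * t i * U i) \<le> \<beta>max * (\<Sum>i=1..j-1. ?w i)"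
      unfolding sum_distrib_left mult.assoc
      using w assms(8) that by (intro sum_mono mult_right_mono) auto
    ultimately show ?thesis using fails[OF that] by linarith
  qed
  let ?Q = "\<Prod>j=1..k-1. (\<beta>max * U j + 1)"
  \<comment> \<open>\<open>D\<close> is \<open>C + \<alpha>max * ?W\<close>, the same for all
    \<open>j\<close>. Only points before \<open>k\<close> enter here; the failure at
    \<open>k\<close>, where the partial sum is all of \<open>?W\<close>, gives the strict inequality
    that follows.\<close>
  have "(C + \<alpha>max * ?W) + \<beta>max * ?W \<le> (C + \<alpha>max * ?W) * ?Q"
  proof (rule additive_recursion_le_prod)
    show "t j \<le> C + \<alpha>max * ?W + \<beta>max * (\<Sum>i=1..j-1. ?w i)" if "j \<in> {1..k-1}" for j
      using less[of j] that by fastforce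
  qed (use pos test in \<open>auto intro: less_imp_le\<close>)
  moreover have "t k < (C + \<alpha>max * ?W) + \<beta>max * ?W"
    using less[of k] assms(1) by simp
  moreover have "0 < ?Q"
    using pos test by (intro prod_pos) (auto intro!: add_pos_pos)
  ultimately have "(\<alpha>max / \<beta>max + 1) / ?Q - \<alpha>max / \<beta>max < C / t k"
    using pos test assms(1) by (intro hyperbolic_bound_less[where W = ?W]) (auto simp: algebra_simps)
  then show False using assms(9) by simp
qed

end
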